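(* There is an absolute constant $c>0$ such that for any positive integer $N$ the set $$\{n^4 : n\in\mathbb{N},\ N\le n \le N+cN^{12/13}\}$$ is not a Sidon set.
   Context: $\mathbb{N}$ denotes the positive integers. A set $\mathcal{A}$ of integers is called a Sidon set if the equation $a_1+a_2=a_3+a_4$ with $a_1,a_2,a_3,a_4\in\mathcal{A}$ has only trivial solutions, i.e. every solution satisfies $\{a_1,a_2\}=\{a_3,a_4\}$. *)

theory Defs
  imports Complex_Main
begin

definition sidon_set :: "int set \<Rightarrow> bool" where
  "sidon_set A \<longleftrightarrow>
     (\<forall>a1\<in>A. \<forall>a2\<in>A. \<forall>a3\<in>A. \<forall>a4\<in>A.
        a1 + a2 = a3 + a4 \<longrightarrow> {a1, a2} = {a3, a4})"

end

theory Submission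
  imports Defs
begin

text \<open>
  The surface \<open>A^4 + B^4 = C^4 + D^4\<close> contains a rational curve of degree 13 that passes through the
  point with all coordinates equal. Concretely, there are monic integer polynomials \<open>f\<close>, \<open>g\<close> of
  degree 13 with \<open>f(x)^4 + g(-x)^4 = g(x)^4 + f(-x)^4\<close>. The four bases \<open>f(x)\<close>, \<open>-g(-x)\<close>, \<open>g(x)\<close>,
  \<open>-f(-x)\<close> all equal \<open>x^13 + O(x^12)\<close>, so for \<open>x = N^(1/13) + O(1)\<close> with a suitable bounded shift
  they lie in a window of length \<open>O(N^(12/13))\<close> starting at \<open>N\<close>. The exponent is thus \<open>1 - 1/13\<close>,
  with 13 the degree of the curve.

  The curve arises as follows. The planes \<open>A + C = t (B + D)\<close> are those through the line \<open>A = -C\<close>,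
  \<open>B = -D\<close> of the surface, and each of them cuts the surface in this line and a plane cubic. In the
  coordinates \<open>p = A - C\<close>, \<open>q = D - B\<close>, \<open>r = B + D\<close> the cubic is
  \<open>t p^3 + t^3 p r^2 = q^3 + q r^2\<close>. The point \<open>p = q = 0\<close>, cut out by the trivial line \<open>A = C\<close>,
  \<open>B = D\<close>, is an inflection, so it is the origin of the group law. The trivial line \<open>A = D\<close>,
  \<open>B = -C\<close> gives the point \<open>P = (1 : t : 1)\<close>. The homogeneous coordinates \<open>A\<close>, \<open>B\<close>, \<open>C\<close>, \<open>D\<close>
  of \<open>3P\<close> are polynomials of degree 13 in \<open>t\<close>, and they all agree at \<open>t = 1\<close>. Writing
  \<open>t = (x + 1) / (x - 1)\<close> moves that value of the parameter to \<open>x = \<infinity>\<close> and, after common factors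
  are cleared, produces \<open>f\<close> and \<open>g\<close>.

  The identity, once known, is a polynomial computation (\<open>quartic_identity\<close>). What remains is that
  the lower-order terms are controlled (\<open>monic_window\<close>), that the solution is nontrivial
  (\<open>f_distinct\<close>), and that rounding \<open>N^(1/13)\<close> up to an integer and shifting it by a constant costs
  only \<open>O(N^(12/13))\<close> after raising to the power 13 (\<open>power_Suc_add_le\<close>).
\<close>

section \<open>The curve of degree 13\<close>

text \<open>These are two of the coordinates of \<open>3P\<close> in the parameter \<open>x\<close>: \<open>A = f(x)\<close> and \<open>C = g(x)\<close>. The
  reflection \<open>x \<mapsto> -x\<close> replaces \<open>t\<close> by \<open>1/t\<close> and exchanges \<open>A\<close> with \<open>D\<close> and \<open>B\<close> with \<open>C\<close> up to a
  common sign, which gives \<open>B = -g(-x)\<close> and \<open>D = -f(-x)\<close>.\<close>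
definition f :: "int \<Rightarrow> int" where
  "f x = x^13 + x^12 - x^11 + 5*x^10 - 6*x^9 - 12*x^8 + 4*x^7 + 7*x^6 + 3*x^5 - 3*x^4 - 4*x^3
         + 2*x^2 + x + 1"

definition g :: "int \<Rightarrow> int" where
  "g x = x^13 + x^12 + 2*x^11 - 4*x^10 - 3*x^9 + 3*x^8 + 7*x^7 + 4*x^6 - 12*x^5 - 6*x^4 + 5*x^3
         - x^2 + x + 1"

lemma quartic_identity: "f x ^ 4 + g (-x) ^ 4 = g x ^ 4 + f (-x) ^ 4"
  unfolding f_def g_def by algebra

text \<open>The constant 50 is the sum of the absolute values of the non-leading coefficients, for \<open>f\<close> and
  for \<open>g\<close>. Negative \<open>x\<close> are included because two of the four bases are values at \<open>-x\<close>.\<close>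
lemma f_g_near_monomial:
  assumes "1 \<le> \<bar>x\<bar>"
  shows "\<bar>f x - x^13\<bar> \<le> 50 * \<bar>x\<bar>^12" and "\<bar>g x - x^13\<bar> \<le> 50 * \<bar>x\<bar>^12"
proof -
  have *: "\<bar>x^k\<bar> \<le> \<bar>x\<bar>^12" if "k \<le> 12" for k
    using power_increasing[OF that assms] by (simp add: power_abs)
  have p: "\<bar>1\<bar> \<le> \<bar>x\<bar>^12" "\<bar>x\<bar> \<le> \<bar>x\<bar>^12" "\<bar>x^2\<bar> \<le> \<bar>x\<bar>^12" "\<bar>x^3\<bar> \<le> \<bar>x\<bar>^12" "\<bar>x^4\<bar> \<le> \<bar>x\<bar>^12"
      "\<bar>x^5\<bar> \<le> \<bar>x\<bar>^12" "\<bar>x^6\<bar> \<le> \<bar>x\<bar>^12" "\<bar>x^7\<bar> \<le> \<bar>x\<bar>^12" "\<bar>x^8\<bar> \<le> \<bar>x\<bar>^12" "\<bar>x^9\<bar> \<le> \<bar>x\<bar>^12"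
      "\<bar>x^10\<bar> \<le> \<bar>x\<bar>^12" "\<bar>x^11\<bar> \<le> \<bar>x\<bar>^12" "\<bar>x^12\<bar> \<le> \<bar>x\<bar>^12"
    using *[of 0] *[of 1] *[of 2] *[of 3] *[of 4] *[of 5] *[of 6] *[of 7] *[of 8] *[of 9] *[of 10]
      *[of 11] *[of 12] by simp_all
  show "\<bar>f x - x^13\<bar> \<le> 50 * \<bar>x\<bar>^12"
    using p unfolding f_def abs_le_iff by linarith
  show "\<bar>g x - x^13\<bar> \<le> 50 * \<bar>x\<bar>^12"
    using p unfolding g_def abs_le_iff by linarith
qed

text \<open>The leading terms are \<open>g(x) - f(x) = 3 x^11 + ...\<close> and \<open>f(x) + f(-x) = 2 x^12 + ...\<close>. They
  dominate once each power of \<open>x\<close> is at least 51 times the previous one.\<close>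
lemma f_distinct:
  assumes "51 \<le> x"
  shows "f x < g x" and "- f (-x) < f x"
proof -
  have step: "51 * x^k \<le> x^Suc k" for k
    using assms by (simp add: mult_right_mono)
  have pos: "0 < x^2"
    using assms by simp
  have s: "51 * x^2 \<le> x^3" "51 * x^3 \<le> x^4" "51 * x^4 \<le> x^5" "51 * x^5 \<le> x^6"
    "51 * x^6 \<le> x^7" "51 * x^7 \<le> x^8" "51 * x^8 \<le> x^9" "51 * x^9 \<le> x^10"
    "51 * x^10 \<le> x^11" "51 * x^11 \<le> x^12"
    using step[of 2] step[of 3] step[of 4] step[of 5] step[of 6] step[of 7] step[of 8] step[of 9]
      step[of 10] step[of 11] by simp_all
  have reflected: "f (-x) = - (x^13) + x^12 + x^11 + 5*x^10 + 6*x^9 - 12*x^8 - 4*x^7 + 7*x^6 - 3*x^5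
      - 3*x^4 + 4*x^3 + 2*x^2 - x + 1"
    unfolding f_def by simp
  show "f x < g x"
    using s pos unfolding f_def g_def by linarith
  show "- f (-x) < f x"
    using s pos unfolding reflected unfolding f_def by linarith
qed

section \<open>From the curve to short windows\<close>

text \<open>Evaluating at \<open>w + 50\<close> instead of \<open>w\<close> absorbs the error term:
  \<open>z^13 - 50 z^12 = z^12 (z - 50)\<close> with \<open>z - 50 = w\<close>.\<close>
lemma monic_window:
  fixes v w :: int
  assumes "0 \<le> w" "\<bar>v - (w + 50)^13\<bar> \<le> 50 * (w + 50)^12"
  shows "w^13 \<le> v" and "v \<le> (w + 100)^13"
proof -
  have split_off: "z^13 = z^12 * z" for z :: int
    by (simp flip: power_Suc2)
  have "w^12 * w \<le> (w + 50)^12 * w"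
    using assms(1) by (intro mult_right_mono power_mono) auto
  then show "w^13 \<le> v"
    using assms(2) unfolding split_off[of w] split_off[of "w + 50"] abs_le_iff
    by (simp add: distrib_left)
  have "(w + 50)^12 * (w + 100) \<le> (w + 100)^12 * (w + 100)"
    using assms(1) by (intro mult_right_mono power_mono) auto
  then show "v \<le> (w + 100)^13"
    using assms(2) unfolding split_off[of "w + 100"] split_off[of "w + 50"] abs_le_iff
    by (simp add: distrib_left)
qed

text \<open>The factor \<open>(1 + m)^(k+1) - 1\<close> is the one with equality at \<open>y = 1\<close>, which is what makes the
  induction close.\<close>
lemma power_Suc_add_le:
  fixes y m :: real
  assumes "1 \<le> y" "0 \<le> m"
  shows "(y + m)^Suc k \<le> y^Suc k + ((1 + m)^Suc k - 1) * y^k"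
proof (induction k)
  case 0
  then show ?case by simp
next
  case (Suc k)
  let ?d = "(1 + m)^Suc k - 1"
  have "0 \<le> ?d" using assms by (simp add: one_le_power del: power_Suc)
  then have "?d * m * y^k \<le> ?d * m * y^Suc k"
    using assms by (intro mult_left_mono power_increasing) auto
  moreover have "(y + m)^Suc (Suc k) \<le> (y^Suc k + ?d * y^k) * (y + m)"
    using Suc.IH assms by (simp add: mult.commute mult_right_mono)
  ultimately show ?case by (simp add: algebra_simps)
qed

text \<open>With \<open>y = N^(1/13)\<close> and \<open>w = \<lceil>y\<rceil>\<close> the window of \<open>monic_window\<close> starts at or after \<open>N\<close> and ends
  at or before \<open>(y + 101)^13\<close>, which explains the constant \<open>102^13\<close>.\<close>
lemma quartic_solution_in_window:
  assumes "N > 0"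
  obtains a b c d :: int where
    "a^4 + b^4 = c^4 + d^4" "a \<noteq> c" "a \<noteq> d"
    "\<And>v. v \<in> {a, b, c, d} \<Longrightarrow> int N \<le> v \<and> of_int v \<le> real N + 102^13 * real N powr (12/13)"
proof -
  define y where "y = real N powr (1/13)"
  define w where "w = \<lceil>y\<rceil>"
  define x where "x = w + 50"
  have y1: "1 \<le> y" using assms unfolding y_def by (simp add: ge_one_powr_ge_zero)
  have yN: "y^13 = real N" "y^12 = real N powr (12/13)"
    using assms unfolding y_def by (simp_all add: powr_powr flip: powr_realpow)
  have w: "y \<le> of_int w" "of_int w \<le> y + 1" "1 \<le> w"
    using y1 unfolding w_def by linarith+
  have "real N \<le> of_int (w^13)"
    using w(1) y1 unfolding yN(1)[symmetric] by (simp add: power_mono)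
  then have Nw: "int N \<le> w^13" by linarith
  have "of_int ((w + 100)^13) \<le> (y + 101)^13"
    using w by (simp add: power_mono)
  also have "\<dots> \<le> y^13 + (102^13 - 1) * y^12"
    using power_Suc_add_le[of y 101 12] y1 by simp
  also have "\<dots> \<le> y^13 + 102^13 * y^12"
    using y1 by (intro add_left_mono mult_right_mono) auto
  finally have wN: "of_int ((w + 100)^13) \<le> real N + 102^13 * real N powr (12/13)"
    unfolding yN .
  have "x \<ge> 51" using w(3) x_def by simp
  have near: "\<bar>v - (w + 50)^13\<bar> \<le> 50 * (w + 50)^12" if "v \<in> {f x, - g (-x), g x, - f (-x)}" for v
    using that f_g_near_monomial[of x] f_g_near_monomial[of "-x"] \<open>x \<ge> 51\<close>
    unfolding x_def[symmetric] by (auto simp: abs_minus_commute)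
  show thesis
  proof (rule that[of "f x" "- g (-x)" "g x" "- f (-x)"])
    show "f x ^ 4 + (- g (-x)) ^ 4 = g x ^ 4 + (- f (-x)) ^ 4"
      using quartic_identity by simp
    show "f x \<noteq> g x" "f x \<noteq> - f (-x)"
      using f_distinct[OF \<open>x \<ge> 51\<close>] by auto
    fix v assume "v \<in> {f x, - g (-x), g x, - f (-x)}"
    from monic_window[OF _ near[OF this]] w(3) have "w^13 \<le> v" "v \<le> (w + 100)^13" by auto
    then show "int N \<le> v \<and> of_int v \<le> real N + 102^13 * real N powr (12/13)"
      using Nw wN by (smt (verit) of_int_le_iff)
  qed
qed

theorem theorem7:
  shows "\<exists>c::real. c > 0 \<and>
    (\<forall>N::nat. N > 0 \<longrightarrow>
      \<not> sidon_set {int n ^ 4 | n :: nat.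
          n > 0 \<and> N \<le> n \<and> real n \<le> real N + c * real N powr (12 / 13)})"
proof (intro exI conjI allI impI)
  show "(102^13 :: real) > 0" by simp
  fix N :: nat
  assume "N > 0"
  let ?S = "{int n ^ 4 | n :: nat.
    n > 0 \<and> N \<le> n \<and> real n \<le> real N + 102^13 * real N powr (12 / 13)}"
  from quartic_solution_in_window[OF \<open>N > 0\<close>] obtain a b c d :: int where
    eq: "a^4 + b^4 = c^4 + d^4" and ne: "a \<noteq> c" "a \<noteq> d" and
    win: "\<And>v. v \<in> {a, b, c, d} \<Longrightarrow>
      int N \<le> v \<and> of_int v \<le> real N + 102^13 * real N powr (12/13)"
    by metis
  have mem: "v^4 \<in> ?S" if "v \<in> {a, b, c, d}" for v
    using win[OF that] \<open>N > 0\<close> by (intro CollectI exI[of _ "nat v"]) auto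
  have pos: "0 < a" "0 < c" "0 < d"
    using win[of a] win[of c] win[of d] \<open>N > 0\<close> by auto
  have "a^4 \<noteq> c^4" "a^4 \<noteq> d^4"
    using ne pos power_eq_iff_eq_base[of 4 a] by auto
  then have "{a^4, b^4} \<noteq> {c^4, d^4}" by auto
  then show "\<not> sidon_set ?S"
    using eq mem[of a] mem[of b] mem[of c] mem[of d] unfolding sidon_set_def by blast
qed

end
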